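(* For any integer $b\ge 1$, there exists a strictly $(1+\frac{1}{2^{b-1}})$-competitive online algorithm with advice for multi-coloring bipartite graphs with advice complexity $b+[\![a]\!]$, where $a+b$ is the total number of bits in the binary representation of $\mathrm{Opt}$.
   Context: Online multi-coloring: the graph is known in advance; requests arrive one at a time, each naming a node $v$, and must immediately and irrevocably receive a color (positive integer) different from every color previously assigned to $v$ or any neighbor of $v$. $A(I)$ is the number of colors used by algorithm $A$ on request sequence $I$ and $\mathrm{Opt}=\mathrm{Opt}(I)$ is the minimum number of colors an offline algorithm needs on $I$. Advice model: an all-powerful oracle knowing $I$ writes an infinite binary advice tape; advice complexity is the maximum index of a bit read. Strictly $c$-competitive means $A(I)\le c\cdot\mathrm{Opt}(I)$ for all $I$. $[\![x]\!]$ denotes the minimum number of bits needed to encode the non-negative integer $x$ in a self-delimiting way. *)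

theory Defs
  imports
    Complex_Main
    "HOL-Library.Log_Nat"
    "HOL-Library.Sublist"
    "Graph_Theory.Pair_Digraph"
begin

section \<open>Multi-coloring\<close>

text \<open>
  Finite simple undirected graphs are the symmetric loop-free digraphs \<open>pair_graph\<close>:
  \<open>u\<close> and \<open>v\<close> are neighbors iff \<open>(u, v) \<in> parcs G\<close>.
\<close>

definition bipartite :: "'v pair_pre_digraph \<Rightarrow> bool" where
  "bipartite G \<longleftrightarrow>
    (\<exists>X Y. pverts G = X \<union> Y \<and> X \<inter> Y = {} \<and> parcs G \<subseteq> X \<times> Y \<union> Y \<times> X)"

definition bipartite_graphs :: "'v pair_pre_digraph set" where
  "bipartite_graphs = {G. pair_graph G \<and> bipartite G}"

text \<open>The entry \<open>cs ! i\<close> is the color given to the request \<open>I ! i\<close>.\<close>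

definition multicoloring :: "'v pair_pre_digraph \<Rightarrow> 'v list \<Rightarrow> nat list \<Rightarrow> bool" where
  "multicoloring G I cs \<longleftrightarrow>
    length cs = length I \<and> (\<forall>c \<in> set cs. c > 0) \<and>
    (\<forall>j < length I. \<forall>i < j.
      I ! i = I ! j \<or> (I ! i, I ! j) \<in> parcs G \<longrightarrow> cs ! i \<noteq> cs ! j)"

definition Opt :: "'v pair_pre_digraph \<Rightarrow> 'v list \<Rightarrow> nat" where
  "Opt G I = (LEAST k. \<exists>cs. multicoloring G I cs \<and> card (set cs) = k)"

section \<open>Online algorithms with advice\<close>

text \<open>\<open>tape i\<close> is the bit with (one-based) index \<open>Suc i\<close>.\<close>

type_synonym tape = "nat \<Rightarrow> bool"

datatype action = Read nat | Color nat

text \<open>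
  To serve a request, an algorithm repeatedly chooses an action: it reads a tape cell, or it
  commits to a color. The choice may depend on the graph, on the requests seen so far (the
  current one being the last), and on the cells read while serving the current request. Bits
  read and colors chosen for earlier requests can be recomputed from this data; rereading a cell
  does not affect the advice complexity, which only depends on the set of cells read.
\<close>

type_synonym 'v algorithm =
  "'v pair_pre_digraph \<Rightarrow> 'v list \<Rightarrow> (nat \<times> bool) list \<Rightarrow> action"

type_synonym 'v advisor = "'v pair_pre_digraph \<Rightarrow> 'v list \<Rightarrow> tape"

text \<open>
  \<open>serve A G \<phi> rs tr c R\<close>: having read \<open>tr\<close> so far, \<open>A\<close> reads exactly the further cells \<open>R\<close>
  and then answers the last request of \<open>rs\<close> with color \<open>c\<close>. There is no such \<open>c\<close> if \<open>A\<close>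
  keeps reading forever.
\<close>

inductive serve ::
  "'v algorithm \<Rightarrow> 'v pair_pre_digraph \<Rightarrow> tape \<Rightarrow> 'v list \<Rightarrow> (nat \<times> bool) list \<Rightarrow> nat \<Rightarrow> nat set \<Rightarrow> bool"
  for A G \<phi> rs where
  color: "A G rs tr = Color c \<Longrightarrow> serve A G \<phi> rs tr c {}"
| read: "A G rs tr = Read i \<Longrightarrow> serve A G \<phi> rs (tr @ [(i, \<phi> i)]) c R \<Longrightarrow>
    serve A G \<phi> rs tr c (insert i R)"

definition run ::
  "'v algorithm \<Rightarrow> 'v pair_pre_digraph \<Rightarrow> tape \<Rightarrow> 'v list \<Rightarrow> nat list \<Rightarrow> nat set \<Rightarrow> bool" where
  "run A G \<phi> I cs R \<longleftrightarrow>
    length cs = length I \<and>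
    (\<exists>Q. (\<forall>j < length I. serve A G \<phi> (take (Suc j) I) [] (cs ! j) (Q j)) \<and>
         R = (\<Union>j < length I. Q j))"

lemma serve_deterministic:
  "serve A G \<phi> rs tr c R \<Longrightarrow> serve A G \<phi> rs tr c' R' \<Longrightarrow> c = c' \<and> R = R'"
proof (induction arbitrary: R' rule: serve.induct)
  case (color tr c)
  then show ?case by (auto elim: serve.cases)
next
  case (read tr i c R)
  from read.prems show ?case
    by (cases rule: serve.cases) (use read in auto)
qed

lemma run_deterministic:
  assumes "run A G \<phi> I cs R" "run A G \<phi> I cs' R'"
  shows "cs = cs' \<and> R = R'"
proof -
  from assms obtain Q Q' where
    Q: "\<forall>j < length I. serve A G \<phi> (take (Suc j) I) [] (cs ! j) (Q j)"
      "R = (\<Union>j < length I. Q j)" "length cs = length I" and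
    Q': "\<forall>j < length I. serve A G \<phi> (take (Suc j) I) [] (cs' ! j) (Q' j)"
      "R' = (\<Union>j < length I. Q' j)" "length cs' = length I"
    unfolding run_def by blast
  have "cs ! j = cs' ! j \<and> Q j = Q' j" if "j < length I" for j
    using Q(1) Q'(1) that serve_deterministic by blast
  then show ?thesis
    using Q Q' by (auto intro: nth_equalityI)
qed

definition max_index :: "nat set \<Rightarrow> nat" where
  "max_index R = Max (insert 0 (Suc ` R))"

definition online_algorithm ::
  "'v pair_pre_digraph set \<Rightarrow> 'v algorithm \<Rightarrow> 'v advisor \<Rightarrow> bool" where
  "online_algorithm \<G> A \<O> \<longleftrightarrow>
    (\<forall>G \<in> \<G>. \<forall>I \<in> lists (pverts G).
      \<exists>cs R. run A G (\<O> G I) I cs R \<and> multicoloring G I cs)"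

definition strictly_competitive ::
  "'v pair_pre_digraph set \<Rightarrow> real \<Rightarrow> 'v algorithm \<Rightarrow> 'v advisor \<Rightarrow> bool" where
  "strictly_competitive \<G> r A \<O> \<longleftrightarrow>
    (\<forall>G \<in> \<G>. \<forall>I \<in> lists (pverts G). \<forall>cs R.
      run A G (\<O> G I) I cs R \<longrightarrow> real (card (set cs)) \<le> r * real (Opt G I))"

text \<open>The bound on the advice complexity is a function of the value of \<open>Opt\<close>.\<close>

definition advice_complexity_le ::
  "'v pair_pre_digraph set \<Rightarrow> (nat \<Rightarrow> nat) \<Rightarrow> 'v algorithm \<Rightarrow> 'v advisor \<Rightarrow> bool" where
  "advice_complexity_le \<G> f A \<O> \<longleftrightarrow>
    (\<forall>G \<in> \<G>. \<forall>I \<in> lists (pverts G). \<forall>cs R.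
      run A G (\<O> G I) I cs R \<longrightarrow> max_index R \<le> f (Opt G I))"

section \<open>Self-delimiting encodings\<close>

text \<open>
  A self-delimiting encoding of the natural numbers is given by its decoder: \<open>D w = Some x\<close> means
  that \<open>w\<close> is a codeword for \<open>x\<close>. A number may have several codewords. No codeword is a proper
  prefix of another, so the end of a codeword on the tape is recognized without reading on.
\<close>

definition self_delimiting :: "(bool list \<Rightarrow> nat option) \<Rightarrow> bool" where
  "self_delimiting D \<longleftrightarrow>
    (\<forall>x. \<exists>w. D w = Some x) \<and>
    (\<forall>u \<in> dom D. \<forall>w \<in> dom D. prefix u w \<longrightarrow> u = w)"

definition enc_bits :: "(bool list \<Rightarrow> nat option) \<Rightarrow> nat \<Rightarrow> nat" where
  "enc_bits D x = (LEAST n. \<exists>w. D w = Some x \<and> length w = n)"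

end

theory Submission
  imports Defs
begin

text \<open>
  If \<open>k \<ge> Opt\<close> is known, give the \<open>n\<close>-th request of a node the color \<open>n\<close> on one side of the
  bipartition and \<open>k + 1 - n\<close> on the other. Two neighbors together receive at most \<open>Opt \<le> k\<close>
  requests, so their color ranges \<open>{1..n}\<close> and \<open>{k + 1 - m..k}\<close> do not meet, and at most \<open>k\<close>
  colors are used. The advice is a codeword for \<open>a\<close> followed by the \<open>b\<close> leading bits \<open>t\<close> of
  \<open>Opt\<close>; it determines \<open>k = (t + 1) 2\<^sup>a - 1\<close>, the largest number with these leading bits, which
  exceeds \<open>Opt\<close> by less than \<open>2\<^sup>a \<le> Opt / 2\<^sup>b\<^sup>-\<^sup>1\<close> (and equals \<open>Opt\<close> if \<open>a = 0\<close>).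
\<close>

section \<open>Lower bounds on \<open>Opt\<close> from cliques\<close>

text \<open>Any two requests to nodes of a clique conflict, so \<open>cs\<close> is injective on
  their positions. The cliques used below are a single node and the two ends of an arc.\<close>

lemma card_clique_requests_le:
  assumes "multicoloring G I cs"
    and clique: "\<And>u v. u \<in> K \<Longrightarrow> v \<in> K \<Longrightarrow> u = v \<or> (u, v) \<in> parcs G"
  shows "length (filter (\<lambda>v. v \<in> K) I) \<le> card (set cs)"
proof -
  let ?S = "{i. i < length I \<and> I ! i \<in> K}"
  have len: "length cs = length I"
    and proper: "\<And>i j. j < length I \<Longrightarrow> i < j \<Longrightarrow> I ! i = I ! j \<or> (I ! i, I ! j) \<in> parcs G \<Longrightarrow>
      cs ! i \<noteq> cs ! j"
    using assms(1) unfolding multicoloring_def by auto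
  have "inj_on ((!) cs) ?S"
    using clique proper by (intro linorder_inj_onI) auto
  moreover have "(!) cs ` ?S \<subseteq> set cs"
    using len by auto
  ultimately have "card ?S \<le> card (set cs)"
    by (metis List.finite_set card_image card_mono)
  then show ?thesis
    by (simp add: length_filter_conv_card)
qed

text \<open>Pairwise distinct colors always form a multicoloring, so the \<open>LEAST\<close> in
  \<open>Opt\<close> ranges over a nonempty set.\<close>

lemma Opt_attained: "\<exists>cs. multicoloring G I cs \<and> card (set cs) = Opt G I"
proof -
  have "multicoloring G I [1..<Suc (length I)]"
    unfolding multicoloring_def by (auto simp del: upt_Suc)
  then show ?thesis
    unfolding Opt_def using LeastI[of "\<lambda>k. \<exists>cs. multicoloring G I cs \<and> card (set cs) = k"] by metis
qed

lemma count_list_le_Opt: "count_list I v \<le> Opt G I"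
proof -
  obtain cs where cs: "multicoloring G I cs" "card (set cs) = Opt G I"
    using Opt_attained by blast
  have "count_list I v = length (filter (\<lambda>w. w \<in> {v}) I)"
    by (induction I) auto
  also have "\<dots> \<le> Opt G I"
    using card_clique_requests_le[OF cs(1), of "{v}"] cs(2) by auto
  finally show ?thesis .
qed

lemma count_list_add_le_Opt:
  assumes "pair_graph G" and "(u, v) \<in> parcs G"
  shows "count_list I u + count_list I v \<le> Opt G I"
proof -
  interpret pair_graph G by fact
  have "(v, u) \<in> parcs G" "u \<noteq> v"
    using arcs_symmetric[OF assms(2)] no_loops[OF assms(2)] by auto
  obtain cs where cs: "multicoloring G I cs" "card (set cs) = Opt G I"
    using Opt_attained by blast
  have "count_list I u + count_list I v = length (filter (\<lambda>w. w \<in> {u, v}) I)"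
    using \<open>u \<noteq> v\<close> by (induction I) auto
  also have "\<dots> \<le> Opt G I"
    using card_clique_requests_le[OF cs(1), of "{u, v}"] cs(2) assms(2) \<open>(v, u) \<in> parcs G\<close> by auto
  finally show ?thesis .
qed

section \<open>The two-sided coloring\<close>

text \<open>The choice depends on \<open>G\<close> alone, so the algorithm uses the same bipartition
  at every request.\<close>

definition left_side :: "'v pair_pre_digraph \<Rightarrow> 'v set" where
  "left_side G = (SOME X. \<exists>Y. pverts G = X \<union> Y \<and> X \<inter> Y = {} \<and> parcs G \<subseteq> X \<times> Y \<union> Y \<times> X)"

lemma left_side_arc:
  assumes "bipartite G" and "(u, v) \<in> parcs G"
  shows "u \<in> left_side G \<longleftrightarrow> v \<notin> left_side G"
proof -
  have "\<exists>Y. pverts G = left_side G \<union> Y \<and> left_side G \<inter> Y = {} \<and>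
      parcs G \<subseteq> left_side G \<times> Y \<union> Y \<times> left_side G"
    using assms(1) unfolding bipartite_def left_side_def by (rule someI_ex)
  then show ?thesis
    using assms(2) by auto
qed

text \<open>\<open>rs\<close> ends with the current request, so \<open>n\<close> is the ordinal of
  this request among those to its node.\<close>

definition two_sided_color :: "'v pair_pre_digraph \<Rightarrow> nat \<Rightarrow> 'v list \<Rightarrow> nat" where
  "two_sided_color G k rs =
    (let n = count_list rs (last rs) in if last rs \<in> left_side G then n else k + 1 - n)"

definition two_sided_coloring :: "'v pair_pre_digraph \<Rightarrow> nat \<Rightarrow> 'v list \<Rightarrow> nat list" where
  "two_sided_coloring G k I = map (\<lambda>j. two_sided_color G k (take (Suc j) I)) [0..<length I]"

lemma count_list_take_le: "count_list (take n xs) x \<le> count_list xs x"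
  by (metis append_take_drop_id count_list_append le_add1)

lemma count_list_take_strict_mono:
  assumes "i < j" and "j < length xs" and "xs ! j = x"
  shows "count_list (take (Suc i) xs) x < count_list (take (Suc j) xs) x"
proof -
  have "count_list (take (Suc i) xs) x \<le> count_list (take j xs) x"
    using assms(1) count_list_take_le[of "Suc i" "take j xs" x] by (simp add: min_def)
  then show ?thesis
    using assms by (simp add: take_Suc_conv_app_nth)
qed

lemma two_sided_coloring_nth:
  assumes "j < length I"
  shows "two_sided_coloring G k I ! j = (let n = count_list (take (Suc j) I) (I ! j) in
    if I ! j \<in> left_side G then n else k + 1 - n)"
  using assms by (simp add: two_sided_coloring_def two_sided_color_def take_Suc_conv_app_nth)

lemma two_sided_coloring_range:
  assumes "Opt G I \<le> k"
  shows "set (two_sided_coloring G k I) \<subseteq> {1..k}"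
proof
  fix c assume "c \<in> set (two_sided_coloring G k I)"
  then obtain j where j: "j < length I" "c = two_sided_coloring G k I ! j"
    by (auto simp: in_set_conv_nth two_sided_coloring_def)
  have "count_list (take (Suc j) I) (I ! j) \<le> k"
    using order_trans[OF count_list_take_le order_trans[OF count_list_le_Opt assms]] .
  moreover have "0 < count_list (take (Suc j) I) (I ! j)"
    using j(1) by (simp add: take_Suc_conv_app_nth)
  ultimately show "c \<in> {1..k}"
    using j by (auto simp: two_sided_coloring_nth Let_def)
qed

lemma multicoloring_two_sided_coloring:
  assumes "pair_graph G" and "bipartite G" and "Opt G I \<le> k"
  shows "multicoloring G I (two_sided_coloring G k I)"
proof -
  have "two_sided_coloring G k I ! i \<noteq> two_sided_coloring G k I ! j"
    if ij: "j < length I" "i < j" and conflict: "I ! i = I ! j \<or> (I ! i, I ! j) \<in> parcs G" for i j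
  proof -
    have le: "count_list (take (Suc l) I) v \<le> count_list I v" "count_list I v \<le> k" for l v
      using count_list_take_le order_trans[OF count_list_le_Opt assms(3)] by auto
    show ?thesis
    proof (cases "I ! i = I ! j")
      \<comment> \<open>The ordinal \<open>n\<close> grows strictly along the requests to one node.
        As \<open>n\<close> \<le> \<open>k\<close>, the subtraction in \<open>k + 1 - n\<close> is
        not truncated, so this color falls strictly.\<close>
      case True
      then show ?thesis
        using ij count_list_take_strict_mono[OF ij(2,1) refl] le(1)[of "Suc j" "I ! j"]
          le(1)[of j "I ! j"] le(2)[of "I ! j"]
        by (auto simp: two_sided_coloring_nth Let_def)
    next
      case False
      then have arc: "(I ! i, I ! j) \<in> parcs G"
        using conflict by blast
      \<comment> \<open>Ordinals are at most total counts, so those of the two requests add up to at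
        most \<open>k\<close>; the left color is then below the right one.\<close>
      have "count_list I (I ! i) + count_list I (I ! j) \<le> k"
        using count_list_add_le_Opt[OF assms(1) arc, of I] assms(3) by linarith
      then show ?thesis
        using ij left_side_arc[OF assms(2) arc] le(1)[of i "I ! i"] le(1)[of j "I ! j"]
        by (auto simp: two_sided_coloring_nth Let_def)
    qed
  qed
  then show ?thesis
    using two_sided_coloring_range[OF assms(3)]
    unfolding multicoloring_def by (auto simp: two_sided_coloring_def)
qed

section \<open>Number of colors recovered from the leading bits\<close>

definition palette_size :: "nat \<Rightarrow> nat \<Rightarrow> nat" where
  "palette_size a t = (t + 1) * 2 ^ a - 1"

lemma le_palette_size: "n \<le> palette_size a (n div 2 ^ a)"
proof -
  have "n < (n div 2 ^ a + 1) * 2 ^ a"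
    using dividend_less_div_times[of "2 ^ a" n] by simp
  then show ?thesis
    unfolding palette_size_def by linarith
qed

lemma palette_size_competitive:
  fixes b n :: nat
  assumes "b \<ge> 1"
  defines "a \<equiv> floorlog 2 n - b"
  shows "real (palette_size a (n div 2 ^ a)) \<le> (1 + 1 / 2 ^ (b - 1)) * real n"
proof (cases "a = 0")
  \<comment> \<open>This covers every \<open>n\<close> with at most \<open>b\<close> bits, including
    0: no bit is cut off and the palette size is \<open>n\<close>.\<close>
  case True
  then show ?thesis
    by (simp add: palette_size_def algebra_simps)
next
  case False
  \<comment> \<open>Since \<open>a\<close> is positive, the subtraction defining it was exact:
    \<open>n\<close> has \<open>a + b\<close> bits and its leading bit weighs
    \<open>2 ^ (a + b - 1)\<close>.\<close>
  then have "n > 0" and "floorlog 2 n - 1 = a + (b - 1)"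
    using assms by (auto simp: a_def floorlog_def split: if_splits)
  then have "2 ^ a * 2 ^ (b - 1) \<le> n"
    using floorlog_bounds[of n 2] by (simp add: power_add)
  then have "2 ^ a * 2 ^ (b - 1) \<le> real n"
    using of_nat_mono[where ?'a = real] by fastforce
  then have "2 ^ a \<le> real n / 2 ^ (b - 1)"
    by (simp add: pos_le_divide_eq)
  moreover have "palette_size a (n div 2 ^ a) \<le> n + 2 ^ a"
    using div_times_less_eq_dividend[of n "2 ^ a"] unfolding palette_size_def add_mult_distrib
    by linarith
  then have "real (palette_size a (n div 2 ^ a)) \<le> real n + 2 ^ a"
    using of_nat_mono[where ?'a = real] by fastforce
  ultimately show ?thesis
    by (simp add: algebra_simps)
qed

section \<open>Writing and decoding the advice\<close>

text \<open>The length of the codeword is not known beforehand, so the last \<open>b\<close> bits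
  read are tentatively taken as the leading bits of \<open>Opt\<close>, least significant first, and
  all bits before them as the codeword. \<open>None\<close> asks for more bits.\<close>

definition parse_advice :: "(bool list \<Rightarrow> nat option) \<Rightarrow> nat \<Rightarrow> bool list \<Rightarrow> nat option" where
  "parse_advice D b zs =
    (if length zs < b then None
     else map_option (\<lambda>a. palette_size a (horner_sum of_bool 2 (drop (length zs - b) zs)))
       (D (take (length zs - b) zs)))"

text \<open>The trace \<open>tr\<close> starts empty at each request, so the advice is reread from
  cell 0, in order; \<open>length tr\<close> is the next cell.\<close>

definition two_sided_algorithm :: "(bool list \<Rightarrow> nat option) \<Rightarrow> nat \<Rightarrow> 'v algorithm" where
  "two_sided_algorithm D b G rs tr =
    (case parse_advice D b (map snd tr) of
       None \<Rightarrow> Read (length tr)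
     | Some k \<Rightarrow> Color (two_sided_color G k rs))"

definition codeword :: "(bool list \<Rightarrow> nat option) \<Rightarrow> nat \<Rightarrow> bool list" where
  "codeword D x = (SOME w. D w = Some x \<and> length w = enc_bits D x)"

text \<open>If \<open>n\<close> has fewer than \<open>b\<close> bits, then \<open>a = 0\<close> and
  the \<open>b\<close> bits are \<open>n\<close> padded with leading zeros.\<close>

definition advice :: "(bool list \<Rightarrow> nat option) \<Rightarrow> nat \<Rightarrow> nat \<Rightarrow> bool list" where
  "advice D b n =
    (let a = floorlog 2 n - b in codeword D a @ map (bit (n div 2 ^ a)) [0..<b])"

lemma codeword:
  assumes "self_delimiting D"
  shows "D (codeword D x) = Some x" "length (codeword D x) = enc_bits D x"
proof -
  have "\<exists>w. D w = Some x \<and> length w = enc_bits D x"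
    unfolding enc_bits_def using assms
    by (intro LeastI_ex[of "\<lambda>n. \<exists>w. D w = Some x \<and> length w = n"])
      (auto simp: self_delimiting_def)
  then have "D (codeword D x) = Some x \<and> length (codeword D x) = enc_bits D x"
    unfolding codeword_def by (rule someI_ex)
  then show "D (codeword D x) = Some x" "length (codeword D x) = enc_bits D x"
    by auto
qed

lemma length_advice:
  assumes "self_delimiting D"
  shows "length (advice D b n) = (let a = floorlog 2 n - b in b + enc_bits D a)"
  using codeword[OF assms] by (simp add: advice_def Let_def)

lemma parse_advice_advice:
  fixes b n :: nat and D :: "bool list \<Rightarrow> nat option"
  assumes "self_delimiting D"
  defines "a \<equiv> floorlog 2 n - b"
  shows "parse_advice D b (advice D b n) = Some (palette_size a (n div 2 ^ a))"
proof -
  \<comment> \<open>Even if the subtraction in \<open>a\<close> truncates, \<open>a + b\<close> is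
    at least the number of bits of \<open>n\<close>; hence the quotient fits into \<open>b\<close>
    bits.\<close>
  have "n < 2 ^ (a + b)"
  proof (cases "n = 0")
    case False
    have "(2::nat) ^ floorlog 2 n \<le> 2 ^ (a + b)"
      unfolding a_def by (intro power_increasing) auto
    then show ?thesis
      using floorlog_bounds[of n 2] False by linarith
  qed simp
  then have "n div 2 ^ a < 2 ^ b"
    by (simp add: less_mult_imp_div_less power_add mult.commute)
  then have "horner_sum of_bool 2 (map (bit (n div 2 ^ a)) [0..<b]) = n div 2 ^ a"
    by (simp add: horner_sum_bit_eq_take_bit take_bit_nat_eq_self)
  then show ?thesis
    using codeword[OF assms(1)] by (simp add: parse_advice_def advice_def Let_def a_def)
qed

text \<open>Reading never stops early: the supposed codeword and the true one would both be prefixes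
  of the advice, hence comparable, hence equal because \<open>D\<close> is self-delimiting; but the
  former is shorter.\<close>

lemma parse_advice_take:
  assumes "self_delimiting D" and "m < length (advice D b n)"
  shows "parse_advice D b (take m (advice D b n)) = None"
proof (rule ccontr)
  define w where "w = codeword D (floorlog 2 n - b)"
  let ?u = "take (m - b) (advice D b n)"
  assume "parse_advice D b (take m (advice D b n)) \<noteq> None"
  then have "b \<le> m" and u: "?u \<in> dom D"
    using assms(2) by (auto simp: parse_advice_def min_def split: if_splits)
  have w: "w \<in> dom D" "prefix w (advice D b n)" "length (advice D b n) = length w + b"
    using codeword[OF assms(1)] by (auto simp: w_def advice_def Let_def)
  have "prefix ?u w \<or> prefix w ?u"
    using w(2) take_is_prefix prefix_same_cases by blast
  then have "?u = w"
    using assms(1) u w(1) unfolding self_delimiting_def by metis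
  then have "length w = m - b"
    using assms(2) by (metis length_take min.absorb4 less_imp_diff_less)
  then show False
    using w(3) assms(2) \<open>b \<le> m\<close> by linarith
qed

text \<open>The tape is infinite, so the finite advice is padded with \<open>False\<close>.\<close>

definition advice_tape :: "bool list \<Rightarrow> tape" where
  "advice_tape zs i = (i < length zs \<and> zs ! i)"

section \<open>Runs of the algorithm\<close>

text \<open>Downward induction on the number \<open>m\<close> of cells already read: a proper prefix
  of the advice cannot be parsed, so cell \<open>m\<close> is read next. The case
  \<open>m = 0\<close> serves a whole request.\<close>

lemma serve_two_sided_algorithm:
  fixes b n :: nat and D :: "bool list \<Rightarrow> nat option"
  assumes "self_delimiting D"
  defines "zs \<equiv> advice D b n"
  assumes "parse_advice D b zs = Some k" and "m \<le> length zs"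
  shows "serve (two_sided_algorithm D b) G (advice_tape zs) rs
    (map (\<lambda>i. (i, advice_tape zs i)) [0..<m]) (two_sided_color G k rs) {m..<length zs}"
  using assms(4)
proof (induction rule: inc_induct)
  case base
  have "map (advice_tape zs) [0..<length zs] = zs"
    by (intro nth_equalityI) (auto simp: advice_tape_def)
  then show ?case
    using assms(3) by (auto intro!: serve.color simp: two_sided_algorithm_def comp_def)
next
  case (step m)
  have "map (advice_tape zs) [0..<m] = take m zs"
    using step.hyps by (intro nth_equalityI) (auto simp: advice_tape_def)
  then have "two_sided_algorithm D b G rs (map (\<lambda>i. (i, advice_tape zs i)) [0..<m]) = Read m"
    using parse_advice_take[OF assms(1)] step.hyps
    by (simp add: two_sided_algorithm_def comp_def zs_def)
  moreover have "{m..<length zs} = insert m {Suc m..<length zs}"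
    using step.hyps by auto
  ultimately show ?case
    using step.IH by (auto intro!: serve.read)
qed

text \<open>Every request reads the same cells; the union is kept because it is empty for an empty
  request sequence.\<close>

lemma run_two_sided_algorithm:
  fixes b n :: nat and D :: "bool list \<Rightarrow> nat option"
  assumes "self_delimiting D"
  defines "zs \<equiv> advice D b n"
  assumes "parse_advice D b zs = Some k"
  shows "run (two_sided_algorithm D b) G (advice_tape zs) I
    (two_sided_coloring G k I) (\<Union>j < length I. {0..<length zs})"
  using serve_two_sided_algorithm[OF assms(1) assms(3)[unfolded zs_def], of 0]
  unfolding run_def zs_def
  by (intro conjI exI[of _ "\<lambda>_. {0..<length (advice D b n)}"]) (auto simp: two_sided_coloring_def)

lemma max_index_le:
  assumes "R \<subseteq> {0..<n}"
  shows "max_index R \<le> n"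
proof -
  have "finite R"
    using assms finite_subset by blast
  then show ?thesis
    using assms unfolding max_index_def by (intro Max.boundedI) (auto simp: Suc_le_eq)
qed

theorem theorem5:
  fixes b :: nat and D :: "bool list \<Rightarrow> nat option"
  assumes "b \<ge> 1" and "self_delimiting D"
  shows "\<exists>(A :: 'v algorithm) (\<O> :: 'v advisor).
    online_algorithm bipartite_graphs A \<O> \<and>
    strictly_competitive bipartite_graphs (1 + 1 / 2 ^ (b - 1)) A \<O> \<and>
    advice_complexity_le bipartite_graphs
      (\<lambda>opt. let a = floorlog 2 opt - b in b + enc_bits D a) A \<O>"
proof -
  define A :: "'v algorithm" where "A = two_sided_algorithm D b"
  define \<O> :: "'v advisor" where "\<O> = (\<lambda>G I. advice_tape (advice D b (Opt G I)))"
  define k where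
    "k n = (let a = floorlog 2 n - b in palette_size a (n div 2 ^ a))" for n
  have le_k: "n \<le> k n" for n
    by (simp add: k_def Let_def le_palette_size)
  have run_A: "run A G (\<O> G I) I (two_sided_coloring G (k (Opt G I)) I)
      (\<Union>j < length I. {0..<length (advice D b (Opt G I))})" for G I
    unfolding A_def \<O>_def k_def Let_def
    using run_two_sided_algorithm[OF assms(2) parse_advice_advice[OF assms(2)]] .
  have "online_algorithm bipartite_graphs A \<O>"
    unfolding online_algorithm_def
  proof (intro ballI exI conjI)
    fix G :: "'v pair_pre_digraph" and I
    assume "G \<in> bipartite_graphs"
    then show "multicoloring G I (two_sided_coloring G (k (Opt G I)) I)"
      by (simp add: bipartite_graphs_def multicoloring_two_sided_coloring le_k)
  qed (rule run_A)
  moreover have "strictly_competitive bipartite_graphs (1 + 1 / 2 ^ (b - 1)) A \<O>"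
    unfolding strictly_competitive_def
  proof (intro ballI allI impI)
    fix G :: "'v pair_pre_digraph" and I cs R
    assume "run A G (\<O> G I) I cs R"
    then have "cs = two_sided_coloring G (k (Opt G I)) I"
      \<comment> \<open>By determinism the arbitrary run \<open>cs\<close>, \<open>R\<close> is the
        one exhibited in \<open>run_A\<close>.\<close>
      using run_deterministic[OF _ run_A] by metis
    then have "set cs \<subseteq> {1..k (Opt G I)}"
      using two_sided_coloring_range le_k by blast
    then have "card (set cs) \<le> k (Opt G I)"
      using card_mono[of "{1..k (Opt G I)}"] by simp
    then show "real (card (set cs)) \<le> (1 + 1 / 2 ^ (b - 1)) * real (Opt G I)"
      using palette_size_competitive[OF assms(1), of "Opt G I"] unfolding k_def Let_def by linarith
  qed
  moreover have "advice_complexity_le bipartite_graphs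
      (\<lambda>opt. let a = floorlog 2 opt - b in b + enc_bits D a) A \<O>"
    \<comment> \<open>The claimed bound is folded back into the length of the advice string, which
      bounds the one-based indices of the cells read.\<close>
    unfolding advice_complexity_le_def length_advice[OF assms(2), symmetric]
  proof (intro ballI allI impI)
    fix G :: "'v pair_pre_digraph" and I cs R
    assume "run A G (\<O> G I) I cs R"
    then have "R = (\<Union>j < length I. {0..<length (advice D b (Opt G I))})"
      using run_deterministic[OF _ run_A] by metis
    then show "max_index R \<le> length (advice D b (Opt G I))"
      by (intro max_index_le) auto
  qed
  ultimately show ?thesis by blast
qed

end
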